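(* In underload ($\rho<1$), any shape of basic activity tree that includes a locally unstable system (i.e., with $A_u$ having an eigenvalue with positive real part) as a subset will, with some set of parameters $(\beta_j)$, $(\mu_{ij})$, become locally unstable. That is: let $\mathcal E$ be a tree on $\mathcal I\cup\mathcal J$ whose edges join customer types to server pools, and let $\mathcal E_U\subseteq\mathcal E$ be a subtree (on $\mathcal I_U\subseteq\mathcal I$, $\mathcal J_U\subseteq\mathcal J$) for which there are parameters $\beta_j>0$ ($j\in\mathcal J_U$), $\mu_{ij}>0$ ($(ij)\in\mathcal E_U$) such that the matrix $A_u$ of the system with tree $\mathcal E_U$ has an eigenvalue with positive real part; then there are parameters $\beta_j>0$ ($j\in\mathcal J$), $\mu_{ij}>0$ ($(ij)\in\mathcal E$) such that the matrix $A_u$ of the system with tree $\mathcal E$ has an eigenvalue with positive real part. In particular, any shape of basic activity tree that includes, as a subtree, the path $1-A-2-B-3-C-4$ with customer types $A,B,C$ and server pools $1,2,3,4$ will be locally unstable for some set of parameters $(\beta_j)$, $(\mu_{ij})$.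
   Context: Model. A system has customer types $i\in\mathcal I$ ($|\mathcal I|=I$), server pools $j\in\mathcal J$ ($|\mathcal J|=J$), input rates $\lambda_i>0$, pool sizes $\beta_j>0$, service rates $\mu_{ij}\ge0$. Static planning problem (SPP): minimize $\rho$ over $(\lambda_{ij}),\rho$ subject to $\lambda_{ij}\ge0$, $\sum_j\lambda_{ij}=\lambda_i$ for all $i$, $\sum_i\lambda_{ij}/(\beta_j\mu_{ij})\le\rho$ for all $j$. It is assumed that the SPP has a unique optimal solution and that the basic activities $\mathcal E=\{(ij):\lambda_{ij}>0\}$ form a (connected) tree on $\mathcal I\cup\mathcal J$; only these activities are used. The system is underloaded if the optimal $\rho<1$. Matrix $A_u$. Put $\mathcal S(i)=\{j:(ij)\in\mathcal E\}$, $\mathcal C(j)=\{i:(ij)\in\mathcal E\}$. For $y\in\mathbb R^I$ let $z=My\in\mathbb R^{\mathcal E}$ be the unique solution of $\sum_{i\in\mathcal C(j)}z_{ij}=\eta\beta_j$ for all $j$ and $\sum_{j\in\mathcal S(i)}z_{ij}=y_i$ for all $i$, where $\eta=\sum_iy_i/\sum_j\beta_j$. $A_u$ is the $I\times I$ matrix of the linear map $y\mapsto\big(-\sum_{j\in\mathcal S(i)}\mu_{ij}(My)_{ij}\big)_{i}$. It depends only on $(\beta_j)$, $(\mu_{ij})_{(ij)\in\mathcal E}$ and $\mathcal E$, not on $(\lambda_i)$, and governs the underloaded fluid model near its equilibrium point through $(\dot\psi_i)=(\lambda_i)+A_u(\psi_i)$. Locally unstable means $A_u$ has an eigenvalue with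 positive real part. *)

theory Defs
  imports
    Complex_Main
    "HOL-Library.Countable_Set"
    "Graph_Theory.Graph_Theory"
    "Jordan_Normal_Form.Char_Poly"
begin

text \<open>
  Customer types form a finite set \<open>I\<close>, server pools a finite set \<open>J\<close>; an activity is a pair
  \<open>(i, j)\<close>. The sum type keeps the two kinds of vertices disjoint, and, as is usual in
  the digraph library, an undirected edge is a pair of opposite arcs.
\<close>

definition activity_graph ::
  "'i set \<Rightarrow> 'j set \<Rightarrow> ('i \<times> 'j) set \<Rightarrow> ('i + 'j) pair_pre_digraph" where
  "activity_graph I J E =
     \<lparr> pverts = I <+> J,
       parcs = (\<lambda>(i, j). (Inl i, Inr j)) ` E \<union> (\<lambda>(i, j). (Inr j, Inl i)) ` E \<rparr>"

text \<open>
  The library's directed notions \<open>forest\<close> and \<open>tree\<close> count the walk \<open>a, b, a\<close> along an edge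
  and back as a cycle, so they cannot be applied to a symmetric digraph. The cycles of the
  undirected graph are the directed cycles of length at least 3.
\<close>

definition activity_tree :: "'i set \<Rightarrow> 'j set \<Rightarrow> ('i \<times> 'j) set \<Rightarrow> bool" where
  "activity_tree I J E \<longleftrightarrow>
     finite I \<and> finite J \<and> E \<subseteq> I \<times> J \<and>
     connected (with_proj (activity_graph I J E)) \<and>
     \<not> (\<exists>p. pre_digraph.cycle (with_proj (activity_graph I J E)) p \<and> 3 \<le> length p)"

definition pools_of :: "('i \<times> 'j) set \<Rightarrow> 'i \<Rightarrow> 'j set" where
  "pools_of E i = {j. (i, j) \<in> E}"

definition types_of :: "('i \<times> 'j) set \<Rightarrow> 'j \<Rightarrow> 'i set" where
  "types_of E j = {i. (i, j) \<in> E}"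

text \<open>
  A vector of \<open>\<real>\<^sup>E\<close> is represented by a function vanishing outside \<open>E\<close>, which makes the
  description in \<open>flow\<close> unique.
\<close>

definition is_flow ::
  "'i set \<Rightarrow> 'j set \<Rightarrow> ('i \<times> 'j) set \<Rightarrow> ('j \<Rightarrow> real) \<Rightarrow> ('i \<Rightarrow> real) \<Rightarrow> ('i \<Rightarrow> 'j \<Rightarrow> real) \<Rightarrow> bool" where
  "is_flow I J E \<beta> y z \<longleftrightarrow>
     (let \<eta> = (\<Sum>i\<in>I. y i) / (\<Sum>j\<in>J. \<beta> j) in
       (\<forall>i j. (i, j) \<notin> E \<longrightarrow> z i j = 0) \<and>
       (\<forall>j\<in>J. (\<Sum>i\<in>types_of E j. z i j) = \<eta> * \<beta> j) \<and>
       (\<forall>i\<in>I. (\<Sum>j\<in>pools_of E i. z i j) = y i))"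

definition flow ::
  "'i set \<Rightarrow> 'j set \<Rightarrow> ('i \<times> 'j) set \<Rightarrow> ('j \<Rightarrow> real) \<Rightarrow> ('i \<Rightarrow> real) \<Rightarrow> 'i \<Rightarrow> 'j \<Rightarrow> real" where
  "flow I J E \<beta> y = (THE z. is_flow I J E \<beta> y z)"

definition underload_map ::
  "'i set \<Rightarrow> 'j set \<Rightarrow> ('i \<times> 'j) set \<Rightarrow> ('j \<Rightarrow> real) \<Rightarrow> ('i \<Rightarrow> 'j \<Rightarrow> real) \<Rightarrow>
     ('i \<Rightarrow> real) \<Rightarrow> 'i \<Rightarrow> real" where
  "underload_map I J E \<beta> \<mu> y i = - (\<Sum>j\<in>pools_of E i. \<mu> i j * flow I J E \<beta> y i j)"

text \<open>
  \<open>from_nat_into I\<close> enumerates the finite set \<open>I\<close> by \<open>{..<card I}\<close>; a different enumeration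
  would give a similar (permuted) matrix. Column \<open>c\<close> is the image of the \<open>c\<close>-th unit vector.
\<close>

definition A_u ::
  "'i set \<Rightarrow> 'j set \<Rightarrow> ('i \<times> 'j) set \<Rightarrow> ('j \<Rightarrow> real) \<Rightarrow> ('i \<Rightarrow> 'j \<Rightarrow> real) \<Rightarrow> real mat" where
  "A_u I J E \<beta> \<mu> =
     mat (card I) (card I)
       (\<lambda>(r, c). underload_map I J E \<beta> \<mu>
                   (\<lambda>i. if i = from_nat_into I c then 1 else 0) (from_nat_into I r))"

definition positive_parameters ::
  "'j set \<Rightarrow> ('i \<times> 'j) set \<Rightarrow> ('j \<Rightarrow> real) \<Rightarrow> ('i \<Rightarrow> 'j \<Rightarrow> real) \<Rightarrow> bool" where
  "positive_parameters J E \<beta> \<mu> \<longleftrightarrow> (\<forall>j\<in>J. 0 < \<beta> j) \<and> (\<forall>(i, j)\<in>E. 0 < \<mu> i j)"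

definition locally_unstable ::
  "'i set \<Rightarrow> 'j set \<Rightarrow> ('i \<times> 'j) set \<Rightarrow> ('j \<Rightarrow> real) \<Rightarrow> ('i \<Rightarrow> 'j \<Rightarrow> real) \<Rightarrow> bool" where
  "locally_unstable I J E \<beta> \<mu> \<longleftrightarrow>
     (\<exists>\<kappa>::complex. eigenvalue (map_mat complex_of_real (A_u I J E \<beta> \<mu>)) \<kappa> \<and> 0 < Re \<kappa>)"

end

theory Submission
  imports Defs
begin

text \<open>
  A tree is obtained from a subtree by attaching one leaf at a time, and each step preserves
  instability. If the leaf is a customer type, every amount of the new type sits on the new edge,
  so the new matrix is block triangular and keeps all eigenvalues of the old one. If the leaf is a
  pool of size \<open>\<epsilon>\<close> attached to the type \<open>i\<close>, it receives a fraction \<open>\<delta> = \<epsilon> / (\<Sum>\<beta> + \<epsilon>)\<close> of the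
  total amount \<open>\<Sum>y\<close>, and the old tree carries the flow of \<open>y - \<delta> (\<Sum>y) e\<^sub>i\<close>; hence the new matrix
  is the old one plus a perturbation that is linear in \<open>\<delta>\<close>, and an eigenvalue with positive real
  part survives for small \<open>\<epsilon>\<close>. For the path with three customer types, unstable parameters are
  given explicitly.
\<close>

section \<open>Continuity of eigenvalues\<close>

text \<open>By the Leibniz formula the determinant is a finite sum of finite products of entries,
  hence continuous in them.\<close>

lemma tendsto_det:
  fixes B :: "'a::{real_normed_field} mat"
  assumes A: "\<And>t. A t \<in> carrier_mat n n" and B: "B \<in> carrier_mat n n"
    and lim: "\<And>r c. r < n \<Longrightarrow> c < n \<Longrightarrow> ((\<lambda>t. A t $$ (r, c)) \<longlongrightarrow> B $$ (r, c)) F"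
  shows "((\<lambda>t. det (A t)) \<longlongrightarrow> det B) F"
proof -
  have "((\<lambda>t. \<Prod>r = 0..<n. A t $$ (r, p r)) \<longlongrightarrow> (\<Prod>r = 0..<n. B $$ (r, p r))) F"
    if "p permutes {0..<n}" for p
    using permutes_in_image[OF that] by (intro tendsto_prod lim) auto
  then show ?thesis
    unfolding det_def'[OF A] det_def'[OF B] by (intro tendsto_sum tendsto_mult tendsto_const) auto
qed

text \<open>
  The characteristic polynomial of \<open>A t\<close> is a product of \<open>n\<close> linear factors, so a small value
  at \<open>\<kappa>\<close> forces a root close to \<open>\<kappa>\<close>.
\<close>

lemma eventually_eigenvalue_near:
  fixes B :: "complex mat"
  assumes A: "\<And>t. A t \<in> carrier_mat n n" and B: "B \<in> carrier_mat n n"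
    and lim: "\<And>r c. r < n \<Longrightarrow> c < n \<Longrightarrow> ((\<lambda>t. A t $$ (r, c)) \<longlongrightarrow> B $$ (r, c)) F"
    and \<kappa>: "eigenvalue B \<kappa>" and "0 < e"
  shows "\<forall>\<^sub>F t in F. \<exists>\<nu>. eigenvalue (A t) \<nu> \<and> cmod (\<kappa> - \<nu>) < e"
proof -
  \<comment> \<open>The determinant of \<open>- char_matrix M \<kappa>\<close> is the value at
    \<kappa> of the characteristic polynomial of \<open>M\<close>; the limit is 0 because \<kappa>
    is an eigenvalue of \<open>B\<close>.\<close>
  have "((\<lambda>t. det (- char_matrix (A t) \<kappa>)) \<longlongrightarrow> det (- char_matrix B \<kappa>)) F"
  proof (rule tendsto_det)
    show "- char_matrix (A t) \<kappa> \<in> carrier_mat n n" for t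
      using A by simp
    show "- char_matrix B \<kappa> \<in> carrier_mat n n"
      using B by simp
    show "((\<lambda>t. (- char_matrix (A t) \<kappa>) $$ (r, c)) \<longlongrightarrow> (- char_matrix B \<kappa>) $$ (r, c)) F"
      if "r < n" "c < n" for r c
      using that carrier_matD[OF A] carrier_matD[OF B] lim[OF that]
      by (auto simp: char_matrix_def intro!: tendsto_intros)
  qed
  then have "((\<lambda>t. poly (char_poly (A t)) \<kappa>) \<longlongrightarrow> 0) F"
    using \<kappa> unfolding eigenvalue_root_char_poly[OF B] char_poly_matrix[OF A] char_poly_matrix[OF B]
    by simp
  \<comment> \<open>The bound \<open>e ^ n\<close> is what a product of \<open>n\<close> factors of
    modulus at least \<open>e\<close> cannot undercut.\<close>
  then have "\<forall>\<^sub>F t in F. cmod (poly (char_poly (A t)) \<kappa>) < e ^ n"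
    using \<open>0 < e\<close> by (auto dest!: tendstoD[of _ _ _ "e ^ n"])
  then show ?thesis
  proof eventually_elim
    case (elim t)
    obtain as where as: "char_poly (A t) = (\<Prod>a\<leftarrow>as. [:- a, 1:])" "length as = n"
      using char_poly_factorized[OF A] by blast
    have val: "poly (\<Prod>a\<leftarrow>bs. [:- a, 1:]) \<kappa> = (\<Prod>a\<leftarrow>bs. \<kappa> - a)" for bs
      by (induction bs) (auto simp: algebra_simps)
    have large: "e ^ length bs \<le> cmod (\<Prod>a\<leftarrow>bs. \<kappa> - a)"
      if "\<forall>a\<in>set bs. e \<le> cmod (\<kappa> - a)" for bs
      using that \<open>0 < e\<close> by (induction bs) (auto simp: norm_mult intro!: mult_mono)
    obtain a where "a \<in> set as" "cmod (\<kappa> - a) < e"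
      using large[of as] elim as val[of as] by fastforce
    moreover have "poly (char_poly (A t)) a = 0"
      using \<open>a \<in> set as\<close> unfolding as(1) by (induction as) auto
    ultimately show ?case
      using eigenvalue_root_char_poly[OF A] by blast
  qed
qed

section \<open>Trees grown leaf by leaf\<close>

definition arcs_of :: "('i \<times> 'j) set \<Rightarrow> ('i + 'j) rel" where
  "arcs_of E = (\<lambda>(i, j). (Inl i, Inr j)) ` E \<union> (\<lambda>(i, j). (Inr j, Inl i)) ` E"

text \<open>Connectivity by plain reachability, so that adding a vertex needs only monotonicity and
  transitivity of the closure.\<close>

definition linked :: "'i set \<Rightarrow> 'j set \<Rightarrow> ('i \<times> 'j) set \<Rightarrow> bool" where
  "linked I J E \<longleftrightarrow> (\<forall>u\<in>I <+> J. \<forall>v\<in>I <+> J. (u, v) \<in> (arcs_of E)\<^sup>*)"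

lemma arcs_of_iff [simp]:
  "(Inl i, Inr j) \<in> arcs_of E \<longleftrightarrow> (i, j) \<in> E"
  "(Inr j, Inl i) \<in> arcs_of E \<longleftrightarrow> (i, j) \<in> E"
  "(Inl i, Inl i') \<notin> arcs_of E"
  "(Inr j, Inr j') \<notin> arcs_of E"
  by (auto simp: arcs_of_def)

lemma arcs_of_mono: "E \<subseteq> E' \<Longrightarrow> arcs_of E \<subseteq> arcs_of E'"
  by (auto simp: arcs_of_def)

lemma activity_graph_simps [simp]:
  "pverts (activity_graph I J E) = I <+> J"
  "parcs (activity_graph I J E) = arcs_of E"
  by (auto simp: activity_graph_def arcs_of_def)

lemma pair_wf_digraph_activity_graph:
  "E \<subseteq> I \<times> J \<Longrightarrow> pair_wf_digraph (activity_graph I J E)"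
  by unfold_locales (auto simp: arcs_of_def)

lemma activity_tree_linked:
  assumes "activity_tree I J E"
  shows "linked I J E" "I <+> J \<noteq> {}"
proof -
  let ?H = "mk_symmetric (with_proj (activity_graph I J E))"
  have H: "strongly_connected (with_proj ?H)"
    using assms by (simp add: activity_tree_def connected_def)
  \<comment> \<open>\<open>connected\<close> is strong connectivity of the symmetrized digraph; here
    the arc set is symmetric already.\<close>
  have "parcs ?H = arcs_of E"
    by (auto simp: parcs_mk_symmetric arcs_of_def)
  then show "linked I J E"
    using H unfolding linked_def strongly_connected_def reachable_def
    by (auto dest!: rtrancl_on_rtranclI)
  show "I <+> J \<noteq> {}"
    using H by (simp add: strongly_connected_def)
qed

text \<open>Any two vertices are joined through \<open>u\<close>, from which \<open>w\<close> is one
  arc away in either direction.\<close>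

lemma linked_insert_vertex:
  assumes "linked I J E" "E \<subseteq> E'" "u \<in> I <+> J"
    and "(u, w) \<in> arcs_of E'" "(w, u) \<in> arcs_of E'" "I' <+> J' = insert w (I <+> J)"
  shows "linked I' J' E'"
proof -
  have old: "(a, b) \<in> (arcs_of E')\<^sup>*" if "a \<in> I <+> J" "b \<in> I <+> J" for a b
    using assms(1) that rtrancl_mono[OF arcs_of_mono[OF assms(2)]] by (auto simp: linked_def)
  have "(a, u) \<in> (arcs_of E')\<^sup>*" "(u, a) \<in> (arcs_of E')\<^sup>*" if "a \<in> insert w (I <+> J)" for a
    using that old assms(3-5) by auto
  then show ?thesis
    unfolding linked_def assms(6) by (meson rtrancl_trans)
qed

lemma linked_insert_pool:
  "linked I J E \<Longrightarrow> i \<in> I \<Longrightarrow> linked I (insert j J) (insert (i, j) E)"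
  by (rule linked_insert_vertex[of I J E _ "Inl i" "Inr j"]) auto

lemma linked_insert_type:
  "linked I J E \<Longrightarrow> j \<in> J \<Longrightarrow> linked (insert i I) J (insert (i, j) E)"
  by (rule linked_insert_vertex[of I J E _ "Inr j" "Inl i"]) auto

lemma rtrancl_leaves:
  assumes "(u, w) \<in> r\<^sup>*" "u \<in> S" "w \<notin> S"
  obtains a b where "(a, b) \<in> r" "a \<in> S" "b \<notin> S"
  using assms by (induction rule: rtrancl_induct) auto

text \<open>An edge of \<open>E\<close> outside \<open>E\<^sub>1\<close> would close a cycle with a
  path in \<open>E\<^sub>1\<close> between its endpoints.\<close>

lemma spanning_linked_subtree:
  assumes tree: "activity_tree I J E" and "E\<^sub>1 \<subseteq> E" and linked: "linked I J E\<^sub>1"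
  shows "E\<^sub>1 = E"
proof (rule ccontr)
  assume "E\<^sub>1 \<noteq> E"
  then obtain i j where ij: "(i, j) \<in> E" "(i, j) \<notin> E\<^sub>1"
    using \<open>E\<^sub>1 \<subseteq> E\<close> by auto
  have E: "E \<subseteq> I \<times> J"
    using tree by (simp add: activity_tree_def)
  let ?G = "activity_graph I J E" and ?G\<^sub>1 = "activity_graph I J E\<^sub>1"
  interpret G: pair_wf_digraph ?G
    using E by (rule pair_wf_digraph_activity_graph)
  interpret G1: pair_wf_digraph ?G\<^sub>1
    using E \<open>E\<^sub>1 \<subseteq> E\<close> by (intro pair_wf_digraph_activity_graph) auto
  have "(Inl i, Inr j) \<in> (arcs_of E\<^sub>1)\<^sup>*"
    using linked ij E by (auto simp: linked_def)
  then have "(Inl i, Inr j) \<in> rtrancl_on (I <+> J) (arcs_of E\<^sub>1)"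
    using ij E \<open>E\<^sub>1 \<subseteq> E\<close> by (intro rtrancl_consistent_rtrancl_on) (auto simp: arcs_of_def)
  then have "Inl i \<rightarrow>\<^sup>*\<^bsub>with_proj ?G\<^sub>1\<^esub> Inr j"
    by (simp add: reachable_def)
  then obtain p where p: "G1.apath (Inl i) p (Inr j)"
    using G1.reachable_apath by blast
  \<comment> \<open>A path of length 0 would identify a type with a pool, and one of length 1 would
    be the missing edge itself. With the closing arc the cycle thus has length at least 3, unlike
    the walk along an edge and back.\<close>
  have "2 \<le> length p"
  proof (rule ccontr)
    assume "\<not> 2 \<le> length p"
    then consider "p = []" | e where "p = [e]"
      by (cases p rule: remdups_adj.cases) auto
    then show False
      using p ij(2) by cases (auto simp: G1.apath_simps)
  qed
  have "G.awalk (Inl i) p (Inr j)" "distinct (pawalk_verts (Inl i) p)"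
    using p arcs_of_mono[OF \<open>E\<^sub>1 \<subseteq> E\<close>]
    by (auto simp: G1.apath_def G1.awalk_def G.awalk_def)
  then have "G.awalk (Inr j) ((Inr j, Inl i) # p) (Inr j)"
    using ij by (simp add: G.awalk_Cons_iff)
  then have "G.cycle ((Inr j, Inl i) # p)"
    using \<open>distinct _\<close> unfolding G.cycle_def by (intro exI[of _ "Inr j"]) auto
  then have "pre_digraph.cycle (with_proj ?G) ((Inr j, Inl i) # p)" .
  then show False
    using tree \<open>2 \<le> length p\<close> unfolding activity_tree_def
    by (metis Suc_le_mono length_Cons numeral_2_eq_2 numeral_3_eq_3)
qed

text \<open>The induction is on the number of missing vertices: by connectivity some edge of the
  tree leads to one of them, and when none is missing, \<open>spanning_linked_subtree\<close> shows
  that all edges are present.\<close>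

lemma activity_tree_leaf_induct [consumes 6, case_names base pool type]:
  assumes tree: "activity_tree I J E"
    and "I\<^sub>0 \<subseteq> I" "J\<^sub>0 \<subseteq> J" "E\<^sub>0 \<subseteq> E" "I\<^sub>0 <+> J\<^sub>0 \<noteq> {}" "linked I\<^sub>0 J\<^sub>0 E\<^sub>0"
    and "P I\<^sub>0 J\<^sub>0 E\<^sub>0"
    and pool: "\<And>I' J' E' i j. P I' J' E' \<Longrightarrow> i \<in> I' \<Longrightarrow> j \<notin> J' \<Longrightarrow>
      P I' (insert j J') (insert (i, j) E')"
    and type: "\<And>I' J' E' i j. P I' J' E' \<Longrightarrow> j \<in> J' \<Longrightarrow> i \<notin> I' \<Longrightarrow>
      P (insert i I') J' (insert (i, j) E')"
  shows "P I J E"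
  using assms(2-7)
proof (induction "card (I - I\<^sub>0) + card (J - J\<^sub>0)" arbitrary: I\<^sub>0 J\<^sub>0 E\<^sub>0 rule: less_induct)
  case less
  have E: "E \<subseteq> I \<times> J" and fin: "finite I" "finite J"
    using tree by (auto simp: activity_tree_def)
  show ?case
  proof (cases "I\<^sub>0 <+> J\<^sub>0 = I <+> J")
    case True
    then have "I\<^sub>0 = I" "J\<^sub>0 = J"
      by (auto simp: set_eq_iff dest: spec[of _ "Inl _"] spec[of _ "Inr _"])
    then show ?thesis
      using spanning_linked_subtree[OF tree] less.prems by blast
  next
    case False
    then obtain u w where "u \<in> I\<^sub>0 <+> J\<^sub>0" "w \<in> I <+> J" "w \<notin> I\<^sub>0 <+> J\<^sub>0"
      using less.prems by blast
    moreover have "(u, w) \<in> (arcs_of E)\<^sup>*"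
      using activity_tree_linked(1)[OF tree] calculation less.prems by (auto simp: linked_def)
    ultimately obtain a b where ab: "(a, b) \<in> arcs_of E" "a \<in> I\<^sub>0 <+> J\<^sub>0" "b \<notin> I\<^sub>0 <+> J\<^sub>0"
      by (meson rtrancl_leaves)
    then consider i j where "(i, j) \<in> E" "i \<in> I\<^sub>0" "j \<notin> J\<^sub>0" | i j where "(i, j) \<in> E" "j \<in> J\<^sub>0" "i \<notin> I\<^sub>0"
      by (auto simp: arcs_of_def)
    then show ?thesis
    proof cases
      case 1
      have "card (J - insert j J\<^sub>0) < card (J - J\<^sub>0)"
        using 1 E fin by (intro psubset_card_mono) auto
      then show ?thesis
        using less.prems 1 E by (intro less.hyps[of I\<^sub>0 "insert j J\<^sub>0" "insert (i, j) E\<^sub>0"])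
          (auto intro: linked_insert_pool pool)
    next
      case 2
      have "card (I - insert i I\<^sub>0) < card (I - I\<^sub>0)"
        using 2 E fin by (intro psubset_card_mono) auto
      then show ?thesis
        using less.prems 2 E by (intro less.hyps[of "insert i I\<^sub>0" J\<^sub>0 "insert (i, j) E\<^sub>0"])
          (auto intro: linked_insert_type type)
    qed
  qed
qed

section \<open>Flows on trees\<close>

text \<open>The pool loads \<open>c\<close> are arbitrary, because removing a leaf that is a type
  changes the load of a single pool and destroys the proportionality to \<beta>.\<close>

definition is_transport ::
  "'i set \<Rightarrow> 'j set \<Rightarrow> ('i \<times> 'j) set \<Rightarrow> ('j \<Rightarrow> real) \<Rightarrow> ('i \<Rightarrow> real) \<Rightarrow> ('i \<Rightarrow> 'j \<Rightarrow> real) \<Rightarrow> bool" where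
  "is_transport I J E c y z \<longleftrightarrow>
     (\<forall>i j. (i, j) \<notin> E \<longrightarrow> z i j = 0) \<and>
     (\<forall>j\<in>J. (\<Sum>i\<in>types_of E j. z i j) = c j) \<and>
     (\<forall>i\<in>I. (\<Sum>j\<in>pools_of E i. z i j) = y i)"

text \<open>The equation \<open>sum y I = sum c J\<close> is the compatibility condition: both sides
  total \<open>z\<close> over \<open>E\<close>.\<close>

definition solvable :: "'i set \<Rightarrow> 'j set \<Rightarrow> ('i \<times> 'j) set \<Rightarrow> bool" where
  "solvable I J E \<longleftrightarrow>
     finite I \<and> finite J \<and> E \<subseteq> I \<times> J \<and>
     (\<forall>c y. sum y I = sum c J \<longrightarrow> (\<exists>!z. is_transport I J E c y z))"

lemma is_flow_iff:
  "is_flow I J E \<beta> y z \<longleftrightarrow> is_transport I J E (\<lambda>j. sum y I / sum \<beta> J * \<beta> j) y z"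
  by (simp add: is_flow_def is_transport_def Let_def)

lemma finite_types_of: "finite I \<Longrightarrow> E \<subseteq> I \<times> J \<Longrightarrow> finite (types_of E j)"
  by (rule finite_subset[of _ I]) (auto simp: types_of_def)

lemma finite_pools_of: "finite J \<Longrightarrow> E \<subseteq> I \<times> J \<Longrightarrow> finite (pools_of E i)"
  by (rule finite_subset[of _ J]) (auto simp: pools_of_def)

lemma pools_of_insert:
  "pools_of (insert (i, j) E) a = (if a = i then insert j (pools_of E a) else pools_of E a)"
  by (auto simp: pools_of_def)

lemma types_of_insert:
  "types_of (insert (i, j) E) b = (if b = j then insert i (types_of E b) else types_of E b)"
  by (auto simp: types_of_def)

text \<open>The equation at the leaf \<open>j\<close> involves a single edge and fixes its flow;
  moving this known amount to the right-hand side at \<open>i\<close> leaves the equations of the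
  old graph. Setting the entry at \<open>(i, j)\<close> to 0 restores the convention that vectors
  vanish outside \<open>E\<close>.\<close>

lemma is_transport_insert_pool:
  assumes "finite J" "E \<subseteq> I \<times> J" "i \<in> I" "j \<notin> J"
  shows "is_transport I (insert j J) (insert (i, j) E) c y z \<longleftrightarrow>
    z i j = c j \<and> is_transport I J E c (y(i := y i - c j)) (\<lambda>a b. if a = i \<and> b = j then 0 else z a b)"
    (is "?L \<longleftrightarrow> ?R")
proof -
  let ?z = "\<lambda>a b. if a = i \<and> b = j then 0 else z a b"
  have fresh: "(a, j) \<notin> E" for a
    using assms by auto
  have "(\<forall>a b. (a, b) \<notin> insert (i, j) E \<longrightarrow> z a b = 0) \<longleftrightarrow> (\<forall>a b. (a, b) \<notin> E \<longrightarrow> ?z a b = 0)"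
    by auto
  moreover have "(\<forall>b\<in>insert j J. (\<Sum>a\<in>types_of (insert (i, j) E) b. z a b) = c b) \<longleftrightarrow>
      z i j = c j \<and> (\<forall>b\<in>J. (\<Sum>a\<in>types_of E b. ?z a b) = c b)"
  proof -
    have "types_of E j = {}"
      using fresh by (auto simp: types_of_def)
    moreover have "(\<Sum>a\<in>types_of E b. ?z a b) = (\<Sum>a\<in>types_of E b. z a b)" if "b \<in> J" for b
      using that assms by (intro sum.cong) auto
    ultimately show ?thesis
      using assms by (auto simp: types_of_insert)
  qed
  moreover have "(\<forall>a\<in>I. (\<Sum>b\<in>pools_of (insert (i, j) E) a. z a b) = y a) \<longleftrightarrow>
      (\<forall>a\<in>I. (\<Sum>b\<in>pools_of E a. ?z a b) = (y(i := y i - z i j)) a)"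
  proof -
    have j: "j \<notin> pools_of E a" for a
      using fresh by (auto simp: pools_of_def)
    then have "(\<Sum>b\<in>pools_of E a. ?z a b) = (\<Sum>b\<in>pools_of E a. z a b)" for a
      by (intro sum.cong) auto
    moreover have "(\<Sum>b\<in>pools_of (insert (i, j) E) a. z a b) =
        (\<Sum>b\<in>pools_of E a. z a b) + (if a = i then z i j else 0)" for a
      using finite_pools_of[OF assms(1,2)] j[of a] by (auto simp: pools_of_insert)
    ultimately show ?thesis
      by (auto split: if_splits)
  qed
  ultimately show ?thesis
    unfolding is_transport_def by auto
qed

lemma solvable_insert_pool:
  assumes solv: "solvable I J E" and i: "i \<in> I" and j: "j \<notin> J"
  shows "solvable I (insert j J) (insert (i, j) E)"
  unfolding solvable_def
proof (intro conjI allI impI)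
  show "finite I" "finite (insert j J)" "insert (i, j) E \<subseteq> I \<times> insert j J"
    using assms by (auto simp: solvable_def)
  fix c :: "'b \<Rightarrow> real" and y :: "'a \<Rightarrow> real"
  assume "sum y I = sum c (insert j J)"
  \<comment> \<open>The amount \<open>c j\<close> is taken from both totals, so the reduced problem
    is balanced again.\<close>
  then have "sum (y(i := y i - c j)) I = sum c J"
    using assms by (auto simp: solvable_def sum.remove[of I i] cong: sum.cong_simp)
  then obtain z where z: "is_transport I J E c (y(i := y i - c j)) z"
    and uniq: "\<And>z'. is_transport I J E c (y(i := y i - c j)) z' \<Longrightarrow> z' = z"
    using solv unfolding solvable_def by metis
  have fresh: "z a j = 0" for a
    using z solv j unfolding is_transport_def solvable_def by blast
  note step = is_transport_insert_pool[of J E I i j c y]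
  have side: "finite J" "E \<subseteq> I \<times> J"
    using solv by (auto simp: solvable_def)
  show "\<exists>!z. is_transport I (insert j J) (insert (i, j) E) c y z"
  proof (rule ex1I)
    let ?z = "\<lambda>a b. if a = i \<and> b = j then c j else z a b"
    have "(\<lambda>a b. if a = i \<and> b = j then 0 else ?z a b) = z"
      using fresh by (auto simp: fun_eq_iff)
    then show "is_transport I (insert j J) (insert (i, j) E) c y ?z"
      unfolding step[OF side i j] using z by simp
    fix z'
    assume "is_transport I (insert j J) (insert (i, j) E) c y z'"
    then have "z' i j = c j" "(\<lambda>a b. if a = i \<and> b = j then 0 else z' a b) = z"
      unfolding step[OF side i j] using uniq by auto
    then show "z' = ?z"
      by (auto simp: fun_eq_iff split: if_splits)
  qed
qed

text \<open>The equations are symmetric in types and pools, so a leaf that is a type can be treated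
  as a leaf that is a pool.\<close>

lemma is_transport_converse:
  "is_transport J I (E\<inverse>) y c (\<lambda>j i. z i j) \<longleftrightarrow> is_transport I J E c y z"
  by (auto simp: is_transport_def types_of_def pools_of_def)

lemma solvable_converse:
  assumes "solvable I J E"
  shows "solvable J I (E\<inverse>)"
  unfolding solvable_def
proof (intro conjI allI impI)
  show "finite J" "finite I" "E\<inverse> \<subseteq> J \<times> I"
    using assms by (auto simp: solvable_def)
  fix c :: "'a \<Rightarrow> real" and y :: "'b \<Rightarrow> real"
  assume "sum y J = sum c I"
  then have ex1: "\<exists>!z. is_transport I J E y c z"
    using assms by (simp add: solvable_def)
  then obtain z where "is_transport I J E y c z"
    by blast
  then have "is_transport J I (E\<inverse>) c y (\<lambda>j i. z i j)"
    by (simp add: is_transport_converse)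
  moreover have "z1 = z2"
    if "is_transport J I (E\<inverse>) c y z1" "is_transport J I (E\<inverse>) c y z2" for z1 z2
  proof -
    have "(\<lambda>i j. z1 j i) = (\<lambda>i j. z2 j i)"
      using that is_transport_converse[of J I E c y "\<lambda>i j. z1 j i"]
        is_transport_converse[of J I E c y "\<lambda>i j. z2 j i"] ex1 by auto
    then show ?thesis
      by (simp add: fun_eq_iff)
  qed
  ultimately show "\<exists>!z. is_transport J I (E\<inverse>) c y z"
    by blast
qed

lemma solvable_insert_type:
  assumes "solvable I J E" "j \<in> J" "i \<notin> I"
  shows "solvable (insert i I) J (insert (i, j) E)"
proof -
  have "solvable J (insert i I) (insert (j, i) (E\<inverse>))"
    using assms by (intro solvable_insert_pool solvable_converse)
  moreover have "(insert (j, i) (E\<inverse>))\<inverse> = insert (i, j) E"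
    by auto
  ultimately show ?thesis
    using solvable_converse by metis
qed

text \<open>With no types the balance condition forces \<open>c j = 0\<close>, and only the zero
  vector is supported on the empty edge set.\<close>

lemma solvable_singleton_pool: "solvable {} {j} {}"
proof -
  have "is_transport {} {j} {} c y z \<longleftrightarrow> z = (\<lambda>_ _. 0)" if "c j = 0" for c y z
    using that by (auto simp: is_transport_def types_of_def fun_eq_iff)
  then show ?thesis
    by (auto simp: solvable_def)
qed

lemma activity_tree_solvable:
  assumes "activity_tree I J E" "J \<noteq> {}"
  shows "solvable I J E"
proof -
  obtain j where "j \<in> J"
    using assms by blast
  show ?thesis
    using assms(1)
  proof (rule activity_tree_leaf_induct[of I J E "{}" "{j}" "{}"])
    show "linked {} {j} {}"
      by (auto simp: linked_def)
  qed (use \<open>j \<in> J\<close> in \<open>auto intro: solvable_singleton_pool solvable_insert_pool solvable_insert_type\<close>)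
qed

section \<open>The matrix of the underloaded system\<close>

text \<open>\<open>solvable\<close> makes the description in \<open>flow\<close> unique, and a
  nonempty \<open>J\<close> makes the denominator of \<eta> positive. Both survive the attachment of
  a leaf.\<close>

locale pool_system =
  fixes I :: "'i set" and J :: "'j set" and E :: "('i \<times> 'j) set"
    and \<beta> :: "'j \<Rightarrow> real" and \<mu> :: "'i \<Rightarrow> 'j \<Rightarrow> real"
  assumes solvable: "solvable I J E" and pools: "J \<noteq> {}"
    and params: "positive_parameters J E \<beta> \<mu>"
begin

abbreviation "\<Phi> \<equiv> flow I J E \<beta>"
abbreviation "\<L> \<equiv> underload_map I J E \<beta> \<mu>"
abbreviation "unit k \<equiv> \<lambda>i::'i. if i = k then 1 else 0 :: real"

lemma finite_I: "finite I" and finite_J: "finite J" and E_subset: "E \<subseteq> I \<times> J"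
  using solvable by (auto simp: solvable_def)

lemma capacity_pos: "0 < sum \<beta> J"
  using finite_J pools params by (auto simp: positive_parameters_def intro!: sum_pos)

lemma ex1_flow: "\<exists>!z. is_flow I J E \<beta> y z"
proof -
  \<comment> \<open>The loads prescribed to the pools add up to the total amount, so the transport
    problem is balanced.\<close>
  have "sum y I = (\<Sum>j\<in>J. sum y I / sum \<beta> J * \<beta> j)"
    using capacity_pos by (simp flip: sum_distrib_left sum_divide_distrib)
  then show ?thesis
    using solvable by (simp add: is_flow_iff solvable_def)
qed

lemma is_flow: "is_flow I J E \<beta> y (\<Phi> y)"
  unfolding flow_def by (rule theI'[OF ex1_flow])

lemma flow_eqI: "is_flow I J E \<beta> y z \<Longrightarrow> \<Phi> y = z"
  using ex1_flow is_flow by blast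

text \<open>Superposing the flows of the unit vectors solves the linear equations for
  \<open>y\<close>, and uniqueness does the rest.\<close>

lemma flow_eq_sum: "\<Phi> y = (\<lambda>i j. \<Sum>k\<in>I. y k * \<Phi> (unit k) i j)"
proof (rule flow_eqI)
  have unit: "is_transport I J E (\<lambda>j. \<beta> j / sum \<beta> J) (unit k) (\<Phi> (unit k))" if "k \<in> I" for k
    using is_flow[of "unit k"] that finite_I by (simp add: is_flow_iff)
  show "is_flow I J E \<beta> y (\<lambda>i j. \<Sum>k\<in>I. y k * \<Phi> (unit k) i j)"
    unfolding is_flow_iff is_transport_def
  proof (intro conjI allI ballI impI)
    fix i j assume "(i, j) \<notin> E"
    then show "(\<Sum>k\<in>I. y k * \<Phi> (unit k) i j) = 0"
      using unit by (auto simp: is_transport_def intro: sum.neutral)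
  next
    fix j assume "j \<in> J"
    have "(\<Sum>i\<in>types_of E j. \<Sum>k\<in>I. y k * \<Phi> (unit k) i j) =
        (\<Sum>k\<in>I. y k * (\<Sum>i\<in>types_of E j. \<Phi> (unit k) i j))"
      by (subst sum.swap) (simp add: sum_distrib_left)
    also have "\<dots> = (\<Sum>k\<in>I. y k * (\<beta> j / sum \<beta> J))"
      using unit \<open>j \<in> J\<close> by (auto simp: is_transport_def intro!: sum.cong)
    finally show "(\<Sum>i\<in>types_of E j. \<Sum>k\<in>I. y k * \<Phi> (unit k) i j) = sum y I / sum \<beta> J * \<beta> j"
      by (simp flip: sum_distrib_right sum_divide_distrib)
  next
    fix i assume "i \<in> I"
    have "(\<Sum>j\<in>pools_of E i. \<Sum>k\<in>I. y k * \<Phi> (unit k) i j) =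
        (\<Sum>k\<in>I. y k * (\<Sum>j\<in>pools_of E i. \<Phi> (unit k) i j))"
      by (subst sum.swap) (simp add: sum_distrib_left)
    also have "\<dots> = (\<Sum>k\<in>I. y k * unit k i)"
      using unit \<open>i \<in> I\<close> by (auto simp: is_transport_def intro!: sum.cong)
    also have "\<dots> = y i"
      using \<open>i \<in> I\<close> finite_I by (simp add: if_distrib[of "\<lambda>x. _ * x"] cong: if_cong)
    finally show "(\<Sum>j\<in>pools_of E i. \<Sum>k\<in>I. y k * \<Phi> (unit k) i j) = y i" .
  qed
qed

lemma underload_map_eq_sum: "\<L> y i = (\<Sum>k\<in>I. y k * \<L> (unit k) i)"
  unfolding underload_map_def
  by (subst flow_eq_sum) (simp add: sum_distrib_left sum_negf mult.left_commute sum.swap[of _ I])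

lemma underload_map_diff_unit:
  assumes "k \<in> I"
  shows "\<L> (\<lambda>i. y i - a * unit k i) i = \<L> y i - a * \<L> (unit k) i"
  unfolding underload_map_eq_sum[of "\<lambda>i. y i - a * unit k i"] underload_map_eq_sum[of y]
  using assms finite_I
  by (simp add: left_diff_distrib sum_subtractf mult.assoc if_distrib[of "\<lambda>x. x * _"]
      flip: sum_distrib_left cong: if_cong)

lemma A_u_carrier: "A_u I J E \<beta> \<mu> \<in> carrier_mat (card I) (card I)"
  by (simp add: A_u_def)

lemma bij_from_nat_into: "bij_betw (from_nat_into I) {..<card I} I"
  by (rule bij_betw_from_nat_into_finite[OF finite_I])

lemma ex_from_nat_into: "i \<in> I \<Longrightarrow> \<exists>r<card I. from_nat_into I r = i"
  using bij_betw_imp_surj_on[OF bij_from_nat_into] by (metis imageE lessThan_iff)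

text \<open>By linearity a row of the matrix applied to \<open>x\<close> is the map at the
  corresponding type; this lets eigenvectors be treated as functions on \<open>I\<close>.\<close>

lemma A_u_mult:
  assumes "r < card I"
  shows "(\<Sum>c<card I. A_u I J E \<beta> \<mu> $$ (r, c) * x (from_nat_into I c)) = \<L> x (from_nat_into I r)"
proof -
  have "(\<Sum>c<card I. A_u I J E \<beta> \<mu> $$ (r, c) * x (from_nat_into I c)) =
      (\<Sum>c<card I. (\<lambda>k. x k * \<L> (unit k) (from_nat_into I r)) (from_nat_into I c))"
    using assms by (intro sum.cong) (auto simp: A_u_def)
  also have "\<dots> = (\<Sum>k\<in>I. x k * \<L> (unit k) (from_nat_into I r))"
    by (rule sum.reindex_bij_betw[OF bij_from_nat_into])
  finally show ?thesis
    by (simp flip: underload_map_eq_sum)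
qed

text \<open>The real and imaginary parts \<open>x\<close>, \<open>y\<close> of an eigenvector for the eigenvalue \<open>a + b i\<close>.\<close>

lemma locally_unstable_iff:
  "locally_unstable I J E \<beta> \<mu> \<longleftrightarrow>
    (\<exists>x y a b. 0 < a \<and> (\<exists>i\<in>I. x i \<noteq> 0 \<or> y i \<noteq> 0) \<and>
      (\<forall>i\<in>I. \<L> x i = a * x i - b * y i \<and> \<L> y i = b * x i + a * y i))"
proof -
  let ?g = "from_nat_into I" and ?n = "card I"
  let ?A = "A_u I J E \<beta> \<mu>"
  let ?C = "map_mat complex_of_real ?A"
  \<comment> \<open>A real matrix acts separately on real and imaginary parts.\<close>
  have mult: "(?C *\<^sub>v v) $ r = Complex (\<L> x (?g r)) (\<L> y (?g r))"
    if "r < ?n" "dim_vec v = ?n" "\<And>c. c < ?n \<Longrightarrow> v $ c = Complex (x (?g c)) (y (?g c))" for v x y r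
  proof -
    have "(?C *\<^sub>v v) $ r = (\<Sum>c<?n. of_real (?A $$ (r, c)) * Complex (x (?g c)) (y (?g c)))"
      using that A_u_carrier by (auto simp: scalar_prod_def atLeast0LessThan intro!: sum.cong)
    then show ?thesis
      using A_u_mult[OF that(1), of x] A_u_mult[OF that(1), of y] by (simp add: complex_eq_iff)
  qed
  show ?thesis
  proof
    assume "locally_unstable I J E \<beta> \<mu>"
    then obtain \<kappa> v where v: "eigenvector ?C v \<kappa>" and "0 < Re \<kappa>"
      by (auto simp: locally_unstable_def eigenvalue_def)
    then have dim: "dim_vec v = ?n" and "v \<noteq> 0\<^sub>v ?n" and ev: "?C *\<^sub>v v = \<kappa> \<cdot>\<^sub>v v"
      using A_u_carrier by (auto simp: eigenvector_def)
    \<comment> \<open>\<open>to_nat_on I\<close> inverts the enumeration, turning the coordinates of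
      \<open>v\<close> into functions of the customer type.\<close>
    define x y where "x = (\<lambda>i. Re (v $ to_nat_on I i))" and "y = (\<lambda>i. Im (v $ to_nat_on I i))"
    have v_eq: "v $ r = Complex (x (?g r)) (y (?g r))" if "r < ?n" for r
      using that bij_betw_imp_surj_on[OF to_nat_on_finite[OF finite_I]]
      by (simp add: x_def y_def)
    have "\<exists>i\<in>I. x i \<noteq> 0 \<or> y i \<noteq> 0"
    proof -
      obtain r where "r < ?n" "v $ r \<noteq> 0"
        using \<open>v \<noteq> 0\<^sub>v ?n\<close> dim by fastforce
      then show ?thesis
        using v_eq[of r] bij_betwE[OF bij_from_nat_into] by (intro bexI[of _ "?g r"]) (auto simp: complex_eq_iff)
    qed
    moreover have "\<L> x i = Re \<kappa> * x i - Im \<kappa> * y i \<and> \<L> y i = Im \<kappa> * x i + Re \<kappa> * y i" if "i \<in> I" for i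
    proof -
      obtain r where r: "r < ?n" "?g r = i"
        using ex_from_nat_into[OF \<open>i \<in> I\<close>] by blast
      have "Complex (\<L> x i) (\<L> y i) = \<kappa> * Complex (x i) (y i)"
        using mult[of r v x y] r dim v_eq ev by simp
      then show ?thesis
        by (simp add: complex_eq_iff algebra_simps)
    qed
    ultimately show "\<exists>x y a b. 0 < a \<and> (\<exists>i\<in>I. x i \<noteq> 0 \<or> y i \<noteq> 0) \<and>
        (\<forall>i\<in>I. \<L> x i = a * x i - b * y i \<and> \<L> y i = b * x i + a * y i)"
      using \<open>0 < Re \<kappa>\<close> by blast
  next
    assume "\<exists>x y a b. 0 < a \<and> (\<exists>i\<in>I. x i \<noteq> 0 \<or> y i \<noteq> 0) \<and>
        (\<forall>i\<in>I. \<L> x i = a * x i - b * y i \<and> \<L> y i = b * x i + a * y i)"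
    then obtain x y a b i where "0 < a" and i: "i \<in> I" "x i \<noteq> 0 \<or> y i \<noteq> 0"
      and ev: "\<And>i. i \<in> I \<Longrightarrow> \<L> x i = a * x i - b * y i" "\<And>i. i \<in> I \<Longrightarrow> \<L> y i = b * x i + a * y i"
      by blast
    define v where "v = vec ?n (\<lambda>r. Complex (x (?g r)) (y (?g r)))"
    have "?C *\<^sub>v v = Complex a b \<cdot>\<^sub>v v"
    proof (rule eq_vecI)
      fix r assume "r < dim_vec (Complex a b \<cdot>\<^sub>v v)"
      then have "r < ?n" "?g r \<in> I"
        using bij_betwE[OF bij_from_nat_into] by (auto simp: v_def)
      then show "(?C *\<^sub>v v) $ r = (Complex a b \<cdot>\<^sub>v v) $ r"
        using mult[of r v x y] ev by (simp add: v_def complex_eq_iff algebra_simps)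
    qed (use A_u_carrier in \<open>simp add: v_def\<close>)
    moreover have "v \<noteq> 0\<^sub>v ?n"
    proof
      assume "v = 0\<^sub>v ?n"
      obtain r where "r < ?n" "?g r = i"
        using ex_from_nat_into[OF \<open>i \<in> I\<close>] by blast
      then have "v $ r \<noteq> 0"
        using i by (auto simp: v_def complex_eq_iff)
      then show False
        using \<open>v = 0\<^sub>v ?n\<close> \<open>r < ?n\<close> by simp
    qed
    ultimately have "eigenvector ?C v (Complex a b)"
      using A_u_carrier by (simp add: eigenvector_def v_def)
    then show "locally_unstable I J E \<beta> \<mu>"
      using \<open>0 < a\<close> unfolding locally_unstable_def eigenvalue_def by force
  qed
qed

lemma locally_unstableI:
  assumes "0 < a" "\<exists>i\<in>I. x i \<noteq> 0 \<or> y i \<noteq> 0"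
    and "\<forall>i\<in>I. \<L> x i = a * x i - b * y i \<and> \<L> y i = b * x i + a * y i"
  shows "locally_unstable I J E \<beta> \<mu>"
  unfolding locally_unstable_iff using assms by blast

end

section \<open>Attaching a leaf\<close>

lemma is_transport_cong:
  assumes "\<And>j. j \<in> J \<Longrightarrow> c j = c' j" "\<And>i. i \<in> I \<Longrightarrow> y i = y' i"
  shows "is_transport I J E c y z \<longleftrightarrow> is_transport I J E c' y' z"
  using assms by (auto simp: is_transport_def)

lemma sum_fun_upd_notin: "a \<notin> A \<Longrightarrow> sum (f(a := b)) A = sum f A"
  by (intro sum.cong) auto

context pool_system
begin

lemma flow_outside: "(i, j) \<notin> E \<Longrightarrow> \<Phi> y i j = 0"
  using is_flow[of y] by (auto simp: is_flow_def Let_def)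

text \<open>Only the size \<open>e\<close> is left free. The rate 1 on the new edge is an arbitrary
  positive choice, since it enters only a term that vanishes with \<open>e\<close>.\<close>

lemma pool_system_insert_pool:
  assumes "i \<in> I" "j \<notin> J" "0 < e"
  shows "pool_system I (insert j J) (insert (i, j) E) (\<beta>(j := e)) (\<mu>(i := (\<mu> i)(j := 1)))"
proof
  show "solvable I (insert j J) (insert (i, j) E)"
    using solvable assms by (intro solvable_insert_pool)
  show "positive_parameters (insert j J) (insert (i, j) E) (\<beta>(j := e)) (\<mu>(i := (\<mu> i)(j := 1)))"
    using params assms by (auto simp: positive_parameters_def)
qed simp

lemma flow_insert_pool:
  fixes e :: real
  assumes i: "i \<in> I" and j: "j \<notin> J" and "0 < e"
  defines "d \<equiv> e / (sum \<beta> J + e)"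
  shows "flow I (insert j J) (insert (i, j) E) (\<beta>(j := e)) y =
    (\<lambda>a b. if a = i \<and> b = j then d * sum y I else \<Phi> (\<lambda>k. y k - d * sum y I * unit i k) a b)"
    (is "_ = ?z")
proof -
  interpret N: pool_system I "insert j J" "insert (i, j) E" "\<beta>(j := e)" "\<mu>(i := (\<mu> i)(j := 1))"
    using assms by (intro pool_system_insert_pool)
  let ?B = "sum \<beta> J" and ?s = "sum y I"
  let ?y = "\<lambda>k. y k - d * ?s * unit i k"
  have "sum (\<beta>(j := e)) (insert j J) = ?B + e"
    using j finite_J by (simp add: sum_fun_upd_notin del: fun_upd_apply add: fun_upd_same)
  moreover have "sum ?y I = ?s - d * ?s"
    using i finite_I by (simp add: sum_subtractf flip: sum_distrib_left)
  \<comment> \<open>The reduced amount over the old capacity equals the full amount over the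
    enlarged one, so both systems load the old pools alike.\<close>
  moreover have "(?s - d * ?s) / ?B = ?s / (?B + e)"
    using capacity_pos \<open>0 < e\<close> by (simp add: d_def divide_simps) (simp add: algebra_simps)
  ultimately have "is_transport I J E (\<lambda>b. ?s / (?B + e) * \<beta> b) ?y (\<Phi> ?y)"
    using is_flow[of ?y] by (simp add: is_flow_iff)
  moreover have "(\<lambda>a b. if a = i \<and> b = j then 0 else ?z a b) = \<Phi> ?y"
  proof -
    have "\<Phi> ?y i j = 0"
      using E_subset j by (intro flow_outside) auto
    then show ?thesis
      by (auto simp: fun_eq_iff)
  qed
  moreover have "is_transport I J E (\<lambda>b. ?s / (?B + e) * (\<beta>(j := e)) b)
      (y(i := y i - ?s / (?B + e) * (\<beta>(j := e)) j)) z \<longleftrightarrow>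
      is_transport I J E (\<lambda>b. ?s / (?B + e) * \<beta> b) ?y z" for z
    using j by (intro is_transport_cong) (auto simp: d_def)
  ultimately have "is_flow I (insert j J) (insert (i, j) E) (\<beta>(j := e)) y ?z"
    unfolding is_flow_iff is_transport_insert_pool[OF finite_J E_subset i j]
      \<open>sum (\<beta>(j := e)) (insert j J) = ?B + e\<close>
    by (simp add: d_def)
  then show ?thesis
    by (rule N.flow_eqI)
qed

text \<open>By linearity, withdrawing the share of the new pool from type \<open>i\<close>
  contributes the term with \<open>\<L> (unit i)\<close>; serving this share at rate 1 on the new
  edge contributes the term with \<open>unit i\<close>.\<close>

lemma underload_map_insert_pool:
  fixes e :: real
  assumes i: "i \<in> I" and j: "j \<notin> J" and "0 < e" and "a \<in> I"
  shows "underload_map I (insert j J) (insert (i, j) E) (\<beta>(j := e)) (\<mu>(i := (\<mu> i)(j := 1))) y a =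
    \<L> y a - e / (sum \<beta> J + e) * (sum y I * (\<L> (unit i) a + unit i a))"
proof -
  let ?d = "e / (sum \<beta> J + e)"
  let ?y = "\<lambda>k. y k - ?d * sum y I * unit i k"
  let ?\<mu> = "\<mu>(i := (\<mu> i)(j := 1))"
  let ?z = "flow I (insert j J) (insert (i, j) E) (\<beta>(j := e)) y"
  have new: "j \<notin> pools_of E a"
    using E_subset j by (auto simp: pools_of_def)
  then have old: "(\<Sum>b\<in>pools_of E a. ?\<mu> a b * ?z a b) = (\<Sum>b\<in>pools_of E a. \<mu> a b * \<Phi> ?y a b)"
    unfolding flow_insert_pool[OF assms(1-3)] by (intro sum.cong) auto
  have "?\<mu> i j * ?z i j = ?d * sum y I"
    unfolding flow_insert_pool[OF assms(1-3)] by simp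
  then have "(\<Sum>b\<in>pools_of (insert (i, j) E) a. ?\<mu> a b * ?z a b) =
      (\<Sum>b\<in>pools_of E a. \<mu> a b * \<Phi> ?y a b) + ?d * sum y I * unit i a"
    unfolding pools_of_insert old[symmetric]
    using new finite_pools_of[OF finite_J E_subset] by (cases "a = i") (simp_all del: fun_upd_apply)
  then have "underload_map I (insert j J) (insert (i, j) E) (\<beta>(j := e)) ?\<mu> y a =
      \<L> ?y a - ?d * sum y I * unit i a"
    by (simp add: underload_map_def del: fun_upd_apply)
  then show ?thesis
    unfolding underload_map_diff_unit[OF i] by (simp add: algebra_simps)
qed

lemma locally_unstable_insert_pool:
  assumes i: "i \<in> I" and j: "j \<notin> J" and "locally_unstable I J E \<beta> \<mu>"
  shows "\<exists>\<beta>' \<mu>'. positive_parameters (insert j J) (insert (i, j) E) \<beta>' \<mu>' \<and>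
    locally_unstable I (insert j J) (insert (i, j) E) \<beta>' \<mu>'"
proof -
  let ?\<mu> = "\<mu>(i := (\<mu> i)(j := 1))" and ?n = "card I"
  let ?A = "\<lambda>e. A_u I (insert j J) (insert (i, j) E) (\<beta>(j := e)) ?\<mu>"
  obtain \<kappa> where \<kappa>: "eigenvalue (map_mat complex_of_real (A_u I J E \<beta> \<mu>)) \<kappa>" and "0 < Re \<kappa>"
    using assms(3) by (auto simp: locally_unstable_def)
  \<comment> \<open>Pool sizes must be positive, hence the limit from the right. The radius
    \<open>Re \<kappa>\<close> is the distance from \<kappa> to the imaginary axis, so an eigenvalue
    closer than this has positive real part.\<close>
  have "\<forall>\<^sub>F e in at_right 0. \<exists>\<nu>. eigenvalue (map_mat complex_of_real (?A e)) \<nu> \<and> cmod (\<kappa> - \<nu>) < Re \<kappa>"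
  proof (rule eventually_eigenvalue_near[OF _ _ _ \<kappa> \<open>0 < Re \<kappa>\<close>])
    show "map_mat complex_of_real (?A e) \<in> carrier_mat ?n ?n" for e
      by (simp add: A_u_def)
    show "map_mat complex_of_real (A_u I J E \<beta> \<mu>) \<in> carrier_mat ?n ?n"
      by (simp add: A_u_def)
    fix r c assume rc: "r < ?n" "c < ?n"
    define a k where "a = from_nat_into I r" and "k = from_nat_into I c"
    have "a \<in> I" "k \<in> I"
      using bij_betwE[OF bij_from_nat_into] rc by (auto simp: a_def k_def)
    define w where "w = \<L> (unit i) a + unit i a"
    \<comment> \<open>A unit vector has total amount 1, so the change is the fixed number
      \<open>w\<close> scaled by the fraction of the new pool.\<close>
    have entry: "?A e $$ (r, c) = A_u I J E \<beta> \<mu> $$ (r, c) - e / (sum \<beta> J + e) * w" if "0 < e" for e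
      using rc underload_map_insert_pool[OF i j \<open>0 < e\<close> \<open>a \<in> I\<close>, of "unit k"] \<open>k \<in> I\<close> finite_I
      by (simp add: A_u_def a_def k_def w_def)
    have "\<forall>\<^sub>F e in at_right 0.
        A_u I J E \<beta> \<mu> $$ (r, c) - e / (sum \<beta> J + e) * w = ?A e $$ (r, c)"
      using eventually_at_right_less[of "0::real"] by eventually_elim (simp add: entry)
    moreover have "((\<lambda>e. A_u I J E \<beta> \<mu> $$ (r, c) - e / (sum \<beta> J + e) * w) \<longlongrightarrow>
        A_u I J E \<beta> \<mu> $$ (r, c) - 0 / (sum \<beta> J + 0) * w) (at_right 0)"
      using capacity_pos by (intro tendsto_intros) auto
    ultimately have "((\<lambda>e. ?A e $$ (r, c)) \<longlongrightarrow> A_u I J E \<beta> \<mu> $$ (r, c)) (at_right 0)"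
      using Lim_transform_eventually by fastforce
    from tendsto_of_real[OF this]
    show "((\<lambda>e. map_mat complex_of_real (?A e) $$ (r, c)) \<longlongrightarrow>
        map_mat complex_of_real (A_u I J E \<beta> \<mu>) $$ (r, c)) (at_right 0)"
      using rc by (simp add: A_u_def)
  qed
  then have "\<forall>\<^sub>F e in at_right 0. 0 < e \<and>
      (\<exists>\<nu>. eigenvalue (map_mat complex_of_real (?A e)) \<nu> \<and> cmod (\<kappa> - \<nu>) < Re \<kappa>)"
    using eventually_at_right_less[of "0::real"] by eventually_elim simp
  from eventually_happens'[OF trivial_limit_at_right_real this]
  obtain e \<nu> where "0 < e" and \<nu>: "eigenvalue (map_mat complex_of_real (?A e)) \<nu>"
    and near: "cmod (\<kappa> - \<nu>) < Re \<kappa>"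
    by blast
  have "0 < Re \<nu>"
    using near complex_Re_le_cmod[of "\<kappa> - \<nu>"] by simp
  then have "locally_unstable I (insert j J) (insert (i, j) E) (\<beta>(j := e)) ?\<mu>"
    using \<nu> by (auto simp: locally_unstable_def)
  then show ?thesis
    using pool_system.params[OF pool_system_insert_pool[OF i j \<open>0 < e\<close>]] by blast
qed

text \<open>An eigenvector extended by 0 at the new type stays an eigenvector: with amount 0 at
  \<open>i\<close> the new edge carries nothing, and neither the total amount nor the total capacity
  changes.\<close>

lemma locally_unstable_insert_type:
  assumes j: "j \<in> J" and i: "i \<notin> I" and "locally_unstable I J E \<beta> \<mu>"
  shows "\<exists>\<beta>' \<mu>'. positive_parameters J (insert (i, j) E) \<beta>' \<mu>' \<and>
    locally_unstable (insert i I) J (insert (i, j) E) \<beta>' \<mu>'"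
proof -
  let ?\<mu> = "\<mu>(i := \<lambda>_. 1)" and ?I = "insert i I" and ?E = "insert (i, j) E"
  interpret N: pool_system ?I J ?E \<beta> ?\<mu>
  proof
    show "solvable ?I J ?E"
      using solvable j i by (intro solvable_insert_type)
    show "positive_parameters J ?E \<beta> ?\<mu>"
      using params by (auto simp: positive_parameters_def)
  qed (rule pools)
  have no_i: "(i, b) \<notin> E" for b
    using E_subset i by auto
  have flow_eq: "N.\<Phi> (x(i := 0)) = \<Phi> x" for x
  proof (rule N.flow_eqI)
    have "sum (x(i := 0)) ?I = sum x I"
      using i finite_I by (simp add: sum_fun_upd_notin del: fun_upd_apply add: fun_upd_same)
    moreover have "(\<Sum>a\<in>types_of ?E b. \<Phi> x a b) = (\<Sum>a\<in>types_of E b. \<Phi> x a b)" for b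
      using no_i finite_types_of[OF finite_I E_subset] flow_outside
      by (simp add: types_of_insert insert_absorb sum.insert_if)
    moreover have "(\<Sum>b\<in>pools_of ?E a. \<Phi> x a b) = (x(i := 0)) a" if "a \<in> ?I" for a
    proof (cases "a = i")
      case True
      then have "\<Phi> x a b = 0" for b
        using no_i flow_outside by blast
      then show ?thesis
        using True by simp
    next
      case False
      then show ?thesis
        using that is_flow[of x] by (simp add: is_flow_def Let_def pools_of_insert)
    qed
    ultimately show "is_flow ?I J ?E \<beta> (x(i := 0)) (\<Phi> x)"
      using is_flow[of x] by (simp add: is_flow_def Let_def)
  qed
  have old: "N.\<L> (x(i := 0)) a = \<L> x a" if "a \<in> I" for x a
  proof -
    have "a \<noteq> i"
      using that i by auto
    then show ?thesis
      by (simp add: underload_map_def flow_eq pools_of_insert)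
  qed
  have new: "N.\<L> (x(i := 0)) i = 0" for x
    using no_i flow_outside by (simp add: underload_map_def flow_eq)
  obtain x y a b where "0 < a" and "\<exists>k\<in>I. x k \<noteq> 0 \<or> y k \<noteq> 0"
    and "\<forall>k\<in>I. \<L> x k = a * x k - b * y k \<and> \<L> y k = b * x k + a * y k"
    using assms(3) unfolding locally_unstable_iff by blast
  moreover from this(2) have "\<exists>k\<in>?I. (x(i := 0)) k \<noteq> 0 \<or> (y(i := 0)) k \<noteq> 0"
    using i by (metis fun_upd_other insertCI)
  moreover from calculation(3) have "\<forall>k\<in>?I.
      N.\<L> (x(i := 0)) k = a * (x(i := 0)) k - b * (y(i := 0)) k \<and>
      N.\<L> (y(i := 0)) k = b * (x(i := 0)) k + a * (y(i := 0)) k"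
    using old new i by auto
  ultimately have "locally_unstable ?I J ?E \<beta> ?\<mu>"
    unfolding N.locally_unstable_iff by blast
  then show ?thesis
    using N.params by blast
qed

end

section \<open>Growing an unstable subtree to the whole tree\<close>

lemma locally_unstable_extend:
  assumes "activity_tree I J E"
    and "I\<^sub>0 \<subseteq> I" "J\<^sub>0 \<subseteq> J" "E\<^sub>0 \<subseteq> E" "linked I\<^sub>0 J\<^sub>0 E\<^sub>0" "solvable I\<^sub>0 J\<^sub>0 E\<^sub>0" "J\<^sub>0 \<noteq> {}"
    and "positive_parameters J\<^sub>0 E\<^sub>0 \<beta>\<^sub>0 \<mu>\<^sub>0" "locally_unstable I\<^sub>0 J\<^sub>0 E\<^sub>0 \<beta>\<^sub>0 \<mu>\<^sub>0"
  shows "\<exists>\<beta> \<mu>. positive_parameters J E \<beta> \<mu> \<and> locally_unstable I J E \<beta> \<mu>"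
proof -
  \<comment> \<open>The invariant includes solvability and the presence of a pool, so that
    \<open>pool_system\<close> is available at every stage; the parameters are quantified inside
    because each leaf may change them.\<close>
  define P where "P I' J' E' \<longleftrightarrow> solvable I' J' E' \<and> J' \<noteq> {} \<and>
    (\<exists>\<beta> \<mu>. positive_parameters J' E' \<beta> \<mu> \<and> locally_unstable I' J' E' \<beta> \<mu>)"
    for I' :: "'a set" and J' :: "'b set" and E'
  have "I\<^sub>0 <+> J\<^sub>0 \<noteq> {}"
    using \<open>J\<^sub>0 \<noteq> {}\<close> by auto
  from assms(1-4) this assms(5) have "P I J E"
  proof (rule activity_tree_leaf_induct)
    show "P I\<^sub>0 J\<^sub>0 E\<^sub>0"
      using assms unfolding P_def by blast
  next
    fix I' J' E' i j assume P: "P I' J' E'" and ij: "i \<in> I'" "j \<notin> J'"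
    then obtain \<beta> \<mu> where "pool_system I' J' E' \<beta> \<mu>" "locally_unstable I' J' E' \<beta> \<mu>"
      by (auto simp: P_def pool_system_def)
    from pool_system.locally_unstable_insert_pool[OF this(1) ij this(2)]
    show "P I' (insert j J') (insert (i, j) E')"
      using P ij by (simp add: P_def solvable_insert_pool)
  next
    fix I' J' E' i j assume P: "P I' J' E'" and ij: "j \<in> J'" "i \<notin> I'"
    then obtain \<beta> \<mu> where "pool_system I' J' E' \<beta> \<mu>" "locally_unstable I' J' E' \<beta> \<mu>"
      by (auto simp: P_def pool_system_def)
    from pool_system.locally_unstable_insert_type[OF this(1) ij this(2)]
    show "P (insert i I') J' (insert (i, j) E')"
      using P ij by (simp add: P_def solvable_insert_type)
  qed
  then show ?thesis
    by (simp add: P_def)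
qed

text \<open>Without activities the matrix is zero and can have no eigenvalue other than 0. This
  rules out unstable subtrees with no pools.\<close>

lemma not_locally_unstable_without_activities:
  assumes "locally_unstable I J {} \<beta> \<mu>"
  shows False
proof -
  let ?n = "card I"
  have zero: "map_mat complex_of_real (A_u I J {} \<beta> \<mu>) = 0\<^sub>m ?n ?n"
    by (rule eq_matI) (auto simp: A_u_def underload_map_def pools_of_def)
  obtain v \<kappa> where v: "v \<in> carrier_vec ?n" "v \<noteq> 0\<^sub>v ?n"
    and "0\<^sub>m ?n ?n *\<^sub>v v = \<kappa> \<cdot>\<^sub>v v" "0 < Re \<kappa>"
    using assms by (auto simp: locally_unstable_def eigenvalue_def eigenvector_def zero)
  moreover obtain r where "r < ?n" "v $ r \<noteq> 0"
    using v by fastforce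
  moreover from this have "(0\<^sub>m ?n ?n *\<^sub>v v) $ r = 0"
    using v by simp
  ultimately have "\<kappa> * v $ r = 0"
    by simp
  then show False
    using \<open>v $ r \<noteq> 0\<close> \<open>0 < Re \<kappa>\<close> by auto
qed

section \<open>The path with three customer types\<close>

definition path_edges :: "'i \<Rightarrow> 'i \<Rightarrow> 'i \<Rightarrow> 'j \<Rightarrow> 'j \<Rightarrow> 'j \<Rightarrow> 'j \<Rightarrow> ('i \<times> 'j) set" where
  "path_edges A B C p1 p2 p3 p4 =
     {(A, p1), (A, p2), (B, p2), (B, p3), (C, p3), (C, p4)}"

text \<open>
  The parameters were found by a numerical search: the matrix of the path has the eigenvalue
  \<open>1 + 20 i\<close> with eigenvector \<open>(-1 + 2 i, 17 + 32 i, 187 - 34 i)\<close>.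
\<close>

lemma path_unstable:
  fixes A B C :: 'i and p1 p2 p3 p4 :: 'j
  assumes dist: "distinct [A, B, C]" "distinct [p1, p2, p3, p4]"
  defines "I \<equiv> {A, B, C}" and "J \<equiv> {p1, p2, p3, p4}" and "E \<equiv> path_edges A B C p1 p2 p3 p4"
  shows "linked I J E" "solvable I J E"
    "\<exists>\<beta> \<mu>. positive_parameters J E \<beta> \<mu> \<and> locally_unstable I J E \<beta> \<mu>"
proof -
  \<comment> \<open>The order of insertion walks along the path from \<open>p1\<close>, so that each
    new vertex is a leaf when it is added.\<close>
  have sets: "I = insert C (insert B (insert A {}))" "J = insert p4 (insert p3 (insert p2 {p1}))"
    "E = insert (C, p4) (insert (C, p3) (insert (B, p3) (insert (B, p2) (insert (A, p2) (insert (A, p1) {})))))"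
    by (auto simp: I_def J_def E_def path_edges_def)
  have "linked {} {p1} {}"
    by (auto simp: linked_def)
  then show "linked I J E"
    unfolding sets by (intro linked_insert_pool linked_insert_type) auto
  show solv: "solvable I J E"
    unfolding sets using dist
    by (intro solvable_insert_pool solvable_insert_type solvable_singleton_pool) auto
  define \<beta> :: "'j \<Rightarrow> real" where "\<beta> j = (if j = p4 then 200 else 1)" for j
  define \<mu> :: "'i \<Rightarrow> 'j \<Rightarrow> real" where
    "\<mu> i j = (if i = A then if j = p1 then 59 else 9
      else if i = B then if j = p2 then 203 else 1
      else if j = p3 then 109 else 11 / 4)" for i j
  have params: "positive_parameters J E \<beta> \<mu>"
    by (auto simp: positive_parameters_def \<beta>_def \<mu>_def)
  interpret pool_system I J E \<beta> \<mu>
    using solv params by unfold_locales (auto simp: J_def)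
  have ne: "A \<noteq> B" "A \<noteq> C" "B \<noteq> A" "B \<noteq> C" "C \<noteq> A" "C \<noteq> B"
    "p1 \<noteq> p2" "p1 \<noteq> p3" "p1 \<noteq> p4" "p2 \<noteq> p1" "p2 \<noteq> p3" "p2 \<noteq> p4"
    "p3 \<noteq> p1" "p3 \<noteq> p2" "p3 \<noteq> p4" "p4 \<noteq> p1" "p4 \<noteq> p2" "p4 \<noteq> p3"
    using dist by auto
  have pools: "pools_of E A = {p1, p2}" "pools_of E B = {p2, p3}" "pools_of E C = {p3, p4}"
    and types: "types_of E p1 = {A}" "types_of E p2 = {A, B}" "types_of E p3 = {B, C}" "types_of E p4 = {C}"
    using ne by (auto simp: pools_of_def types_of_def E_def path_edges_def)
  define v :: "real \<Rightarrow> real \<Rightarrow> real \<Rightarrow> 'i \<Rightarrow> real" where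
    "v a b c i = (if i = A then a else if i = B then b else c)" for a b c i
  define z :: "real \<Rightarrow> real \<Rightarrow> real \<Rightarrow> real \<Rightarrow> real \<Rightarrow> real \<Rightarrow> 'i \<Rightarrow> 'j \<Rightarrow> real" where
    "z a1 a2 b2 b3 c3 c4 i j =
      (if (i, j) = (A, p1) then a1 else if (i, j) = (A, p2) then a2
       else if (i, j) = (B, p2) then b2 else if (i, j) = (B, p3) then b3
       else if (i, j) = (C, p3) then c3 else if (i, j) = (C, p4) then c4 else 0)"
    for a1 a2 b2 b3 c3 c4 i j
  note eqs = I_def J_def pools types v_def z_def \<beta>_def \<mu>_def ne
  have outside: "z a1 a2 b2 b3 c3 c4 i j = 0" if "(i, j) \<notin> E" for a1 a2 b2 b3 c3 c4 i j
    using that by (auto simp: z_def E_def path_edges_def)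
  \<comment> \<open>The capacities total 203, as does the real part of the eigenvector, while its
    imaginary part totals 0. So \<eta> is 1 and 0 respectively, and the entries follow one by one
    along the path from the leaf \<open>p1\<close>.\<close>
  have re: "\<Phi> (v (- 1) 17 187) = z 1 (- 2) 3 14 (- 13) 200"
    using outside by (intro flow_eqI) (simp add: is_flow_def eqs)
  have im: "\<Phi> (v 2 32 (- 34)) = z 0 2 (- 2) 34 (- 34) 0"
    using outside by (intro flow_eqI) (simp add: is_flow_def eqs)
  have "locally_unstable I J E \<beta> \<mu>"
  proof (rule locally_unstableI)
    show "0 < (1::real)"
      by simp
    show "\<forall>i\<in>I. \<L> (v (- 1) 17 187) i = 1 * v (- 1) 17 187 i - 20 * v 2 32 (- 34) i \<and>
        \<L> (v 2 32 (- 34)) i = 20 * v (- 1) 17 187 i + 1 * v 2 32 (- 34) i"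
      unfolding underload_map_def re im by (simp add: eqs)
    show "\<exists>i\<in>I. v (- 1) 17 187 i \<noteq> 0 \<or> v 2 32 (- 34) i \<noteq> 0"
      by (intro bexI[of _ A]) (simp_all add: v_def I_def)
  qed
  then show "\<exists>\<beta> \<mu>. positive_parameters J E \<beta> \<mu> \<and> locally_unstable I J E \<beta> \<mu>"
    using params by blast
qed

section \<open>Unstable subtrees and the path inside an arbitrary tree\<close>

theorem lemma5p4:
  fixes I :: "'i set" and J :: "'j set" and E :: "('i \<times> 'j) set"
  assumes tree: "activity_tree I J E"
  shows
    "(\<forall>I\<^sub>U J\<^sub>U E\<^sub>U.
        I\<^sub>U \<subseteq> I \<and> J\<^sub>U \<subseteq> J \<and> E\<^sub>U \<subseteq> E \<and> activity_tree I\<^sub>U J\<^sub>U E\<^sub>U \<and>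
        (\<exists>\<beta> \<mu>. positive_parameters J\<^sub>U E\<^sub>U \<beta> \<mu> \<and> locally_unstable I\<^sub>U J\<^sub>U E\<^sub>U \<beta> \<mu>)
        \<longrightarrow> (\<exists>\<beta> \<mu>. positive_parameters J E \<beta> \<mu> \<and> locally_unstable I J E \<beta> \<mu>))
     \<and>
     (\<forall>A B C p1 p2 p3 p4.
        distinct [A, B, C] \<and> distinct [p1, p2, p3, p4] \<and>
        {(A, p1), (A, p2), (B, p2), (B, p3), (C, p3), (C, p4)} \<subseteq> E
        \<longrightarrow> (\<exists>\<beta> \<mu>. positive_parameters J E \<beta> \<mu> \<and> locally_unstable I J E \<beta> \<mu>))"
proof (intro conjI allI impI; elim conjE exE)
  fix I\<^sub>U J\<^sub>U E\<^sub>U \<beta> \<mu>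
  assume sub: "I\<^sub>U \<subseteq> I" "J\<^sub>U \<subseteq> J" "E\<^sub>U \<subseteq> E" and tree_U: "activity_tree I\<^sub>U J\<^sub>U E\<^sub>U"
    and \<beta>\<mu>: "positive_parameters J\<^sub>U E\<^sub>U \<beta> \<mu>" "locally_unstable I\<^sub>U J\<^sub>U E\<^sub>U \<beta> \<mu>"
  have "J\<^sub>U \<noteq> {}"
  proof
    assume "J\<^sub>U = {}"
    then have "E\<^sub>U = {}"
      using tree_U by (auto simp: activity_tree_def)
    then show False
      using \<beta>\<mu> not_locally_unstable_without_activities by metis
  qed
  then show "\<exists>\<beta> \<mu>. positive_parameters J E \<beta> \<mu> \<and> locally_unstable I J E \<beta> \<mu>"
    using locally_unstable_extend[OF tree sub] activity_tree_linked(1)[OF tree_U]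
      activity_tree_solvable[OF tree_U] \<beta>\<mu> by blast
next
  fix A B C p1 p2 p3 p4
  assume dist: "distinct [A, B, C]" "distinct [p1, p2, p3, p4]"
    and E: "{(A, p1), (A, p2), (B, p2), (B, p3), (C, p3), (C, p4)} \<subseteq> E"
  note path = path_unstable[OF dist]
  have "E \<subseteq> I \<times> J"
    using tree by (simp add: activity_tree_def)
  then have "{A, B, C} \<subseteq> I" "{p1, p2, p3, p4} \<subseteq> J" "path_edges A B C p1 p2 p3 p4 \<subseteq> E"
    using E by (auto simp: path_edges_def)
  \<comment> \<open>The path enters through \<open>linked\<close> and \<open>solvable\<close>, both
    of which were built up along it leaf by leaf.\<close>
  then show "\<exists>\<beta> \<mu>. positive_parameters J E \<beta> \<mu> \<and> locally_unstable I J E \<beta> \<mu>"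
    using locally_unstable_extend[OF tree _ _ _ path(1,2)] path(3) by blast
qed

end
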